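(* Let $n\ge1$. The reduced turning number is a lumping of $S_n$: the sums $\sum_\sigma\sigma$ over all $\sigma\in S_n$ with a given reduced turning number form a basis of a subalgebra of the group algebra $\mathbf{Q}[S_n]$ (the reduced turning algebra), and this subalgebra is commutative.
   Context: $S_n$ is the symmetric group on $\{1,\dots,n\}$, with permutations composed left to right: $(\sigma\tau)(i)=\tau(\sigma(i))$. The reduced turning number of $\sigma\in S_n$ is the number of $i$ with $1<i<n$ such that $\sigma(i)-\sigma(i-1)$ and $\sigma(i+1)-\sigma(i)$ have opposite signs (i.e. the number of interior local maxima and minima of the piecewise linear graph of $\sigma$; no turning point is recognized at $1$ or at $n$). In particular both the identity and the order-reversing permutation have reduced turning number $0$. "Subalgebra" means a linear subspace closed under multiplication; it is not required to contain the identity element of $S_n$. *)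

theory Defs
  imports Complex_Main "HOL-Library.Poly_Mapping" "HOL-Combinatorics.Permutations"
begin

definition sym_perms :: "nat \<Rightarrow> (nat \<Rightarrow> nat) set" where
  "sym_perms n = {\<sigma>. \<sigma> permutes {1..n}}"

text \<open>Elements of the group algebra are formal rational combinations of permutations; the
  permutation \<open>\<sigma>\<close> itself is \<^term>\<open>Poly_Mapping.single \<sigma> (1::rat)\<close>. The degree \<open>n\<close> is not part of
  the type, so the carrier of the group algebra of the symmetric group is an explicit set.\<close>

type_synonym perm_comb = "(nat \<Rightarrow> nat) \<Rightarrow>\<^sub>0 rat"

definition group_algebra :: "nat \<Rightarrow> perm_comb set" where
  "group_algebra n = {x. Poly_Mapping.keys x \<subseteq> sym_perms n}"

definition qscale :: "rat \<Rightarrow> perm_comb \<Rightarrow> perm_comb" where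
  "qscale c x = Poly_Mapping.map (\<lambda>a. c * a) x"

text \<open>Permutations are composed left to right: \<open>\<sigma>\<close> followed by \<open>\<tau>\<close> is \<^term>\<open>\<tau> \<circ> \<sigma>\<close>.\<close>

definition gmult :: "perm_comb \<Rightarrow> perm_comb \<Rightarrow> perm_comb" (infixl \<open>\<odot>\<close> 70) where
  "x \<odot> y = (\<Sum>\<sigma>\<in>Poly_Mapping.keys x. \<Sum>\<tau>\<in>Poly_Mapping.keys y.
     Poly_Mapping.single (\<tau> \<circ> \<sigma>) (Poly_Mapping.lookup x \<sigma> * Poly_Mapping.lookup y \<tau>))"

lemma lookup_qscale: "Poly_Mapping.lookup (qscale c x) \<sigma> = c * Poly_Mapping.lookup x \<sigma>"
  by (simp add: qscale_def map.rep_eq when_def)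

lemma gmult_single:
  "Poly_Mapping.single \<sigma> a \<odot> Poly_Mapping.single \<tau> b = Poly_Mapping.single (\<tau> \<circ> \<sigma>) (a * b)"
  by (cases "a = 0"; cases "b = 0") (simp_all add: gmult_def)

global_interpretation QG: vector_space qscale
  by unfold_locales (auto intro!: poly_mapping_eqI simp: lookup_qscale lookup_add algebra_simps)

definition subalgebra :: "nat \<Rightarrow> perm_comb set \<Rightarrow> bool" where
  "subalgebra n A \<longleftrightarrow> A \<subseteq> group_algebra n \<and> QG.subspace A \<and> (\<forall>x\<in>A. \<forall>y\<in>A. x \<odot> y \<in> A)"

definition class_sum :: "nat \<Rightarrow> ((nat \<Rightarrow> nat) \<Rightarrow> 'k) \<Rightarrow> 'k \<Rightarrow> perm_comb" where
  "class_sum n f k = (\<Sum>\<sigma> | \<sigma> \<in> sym_perms n \<and> f \<sigma> = k. Poly_Mapping.single \<sigma> 1)"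

definition is_basis_family :: "'k set \<Rightarrow> ('k \<Rightarrow> perm_comb) \<Rightarrow> perm_comb set \<Rightarrow> bool" where
  "is_basis_family I v A \<longleftrightarrow> inj_on v I \<and> QG.independent (v ` I) \<and> QG.span (v ` I) = A"

text \<open>Only attained values index a class sum: for the others the sum is empty, hence zero.\<close>

definition is_lumping :: "nat \<Rightarrow> ((nat \<Rightarrow> nat) \<Rightarrow> 'k) \<Rightarrow> bool" where
  "is_lumping n f \<longleftrightarrow>
     (\<exists>A. subalgebra n A \<and> is_basis_family (f ` sym_perms n) (class_sum n f) A)"

definition reduced_turning_number :: "nat \<Rightarrow> (nat \<Rightarrow> nat) \<Rightarrow> nat" where
  "reduced_turning_number n \<sigma> =
     card {i. 1 < i \<and> i < n \<and>
              (int (\<sigma> i) - int (\<sigma> (i - 1))) * (int (\<sigma> (i + 1)) - int (\<sigma> i)) < 0}"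

definition reduced_turning_algebra :: "nat \<Rightarrow> perm_comb set" where
  "reduced_turning_algebra n =
     QG.span (class_sum n (reduced_turning_number n) ` reduced_turning_number n ` sym_perms n)"

end

theory Submission
  imports Defs "HOL-Computational_Algebra.Formal_Power_Series"
begin

text \<open>Let \<open>H\<^sub>a\<close> be the sum, over both piecewise linear zigzag maps of the unit interval with \<open>a\<close> branches
  (starting upwards or downwards), of all the ways in which such a map can rearrange \<open>n\<close> points.
  Zigzag maps compose to zigzag maps, and \<open>H\<^sub>a H\<^sub>b = 2 H\<^sub>a\<^sub>b\<close>. The combinatorial model labels each
  card by a branch. The generating function in \<open>a\<close> of the coefficients of \<open>H\<^sub>a\<close> at \<open>\<sigma>\<close> is a product of
  \<open>2 \<times> 2\<close> transfer matrices of rank one, one for each ascent or descent of \<open>\<sigma>\<close>: with \<open>u = (1, x)\<close> and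
  \<open>v = (x, 1)\<close>, the matrices are \<open>u\<^sup>T u / (1 - x\<^sup>2)\<close> and \<open>v\<^sup>T v / (1 - x\<^sup>2)\<close>. So a turn contributes
  \<open>u v\<^sup>T = 2 x\<close> and a non-turn contributes \<open>u u\<^sup>T = 1 + x\<^sup>2\<close>. Hence the coefficients only depend on the number
  \<open>t\<close> of turns, and they start in degree \<open>t\<close>, so the \<open>H\<^sub>a\<close> and the class sums are related
  triangularly and have the same span.\<close>

section \<open>Sorting permutations of strict linear orders\<close>

definition sorts :: "('a \<Rightarrow> 'a \<Rightarrow> bool) \<Rightarrow> nat \<Rightarrow> (nat \<Rightarrow> 'a) \<Rightarrow> bool" where
  "sorts R n \<sigma> \<longleftrightarrow> (\<forall>i\<in>{1..n}. \<forall>j\<in>{1..n}. i < j \<longrightarrow> R (\<sigma> i) (\<sigma> j))"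

text \<open>In a sorting permutation \<open>\<rho>\<close> the elements at or below
  \<open>\<rho> i\<close> in \<open>R\<close> are exactly \<open>\<rho> 1, ..., \<rho> i\<close>. So
  \<open>i\<close> is the rank of \<open>\<rho> i\<close>, and \<open>R\<close> determines
  \<open>\<rho>\<close>.\<close>

lemma sorts_unique:
  fixes R :: "nat \<Rightarrow> nat \<Rightarrow> bool"
  assumes "transp R" "irreflp R"
    and "\<sigma> permutes {1..n}" "sorts R n \<sigma>" "\<tau> permutes {1..n}" "sorts R n \<tau>"
  shows "\<sigma> = \<tau>"
proof -
  have rank: "card {j\<in>{1..n}. j = \<rho> i \<or> R j (\<rho> i)} = i"
    if \<rho>: "\<rho> permutes {1..n}" "sorts R n \<rho>" and i: "i \<in> {1..n}" for \<rho> i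
  proof -
    have "{j\<in>{1..n}. j = \<rho> i \<or> R j (\<rho> i)} = \<rho> ` {1..i}"
    proof (intro equalityI subsetI)
      fix j assume "j \<in> {j\<in>{1..n}. j = \<rho> i \<or> R j (\<rho> i)}"
      then have j: "j \<in> {1..n}" "j = \<rho> i \<or> R j (\<rho> i)" by auto
      obtain k where k: "k \<in> {1..n}" "j = \<rho> k"
        using \<rho>(1) j(1) by (metis imageE permutes_image)
      have "\<not> i < k"
      proof
        assume "i < k"
        then have "R (\<rho> i) (\<rho> k)" using \<rho>(2) i k(1) unfolding sorts_def by blast
        moreover have "\<rho> i \<noteq> \<rho> k"
          using \<open>i < k\<close> \<rho>(1) by (metis inj_eq permutes_inj nat_less_le)
        ultimately show False using j(2) k(2) assms(1,2)
          by (metis irreflp_def transpD)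
      qed
      then show "j \<in> \<rho> ` {1..i}" using k by auto
    next
      fix j assume "j \<in> \<rho> ` {1..i}"
      then obtain k where k: "k \<in> {1..i}" "j = \<rho> k" by auto
      then have kn: "k \<in> {1..n}" using i by auto
      then have "\<rho> k \<in> {1..n}" using \<rho>(1) by (metis permutes_in_image)
      moreover have "k = i \<or> k < i" using k by auto
      ultimately show "j \<in> {j\<in>{1..n}. j = \<rho> i \<or> R j (\<rho> i)}"
        using \<rho>(2) kn i k(2) unfolding sorts_def by auto
    qed
    moreover have "inj_on \<rho> {1..i}" using \<rho>(1) by (meson inj_on_subset permutes_inj subset_UNIV)
    ultimately show ?thesis by (simp add: card_image)
  qed
  show ?thesis
  proof
    fix i
    show "\<sigma> i = \<tau> i"
    proof (cases "i \<in> {1..n}")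
      case False
      then show ?thesis using assms(3,5) by (simp add: permutes_def)
    next
      case i: True
      obtain k where k: "k \<in> {1..n}" "\<sigma> i = \<tau> k"
        using assms(3,5) i by (metis imageE permutes_image permutes_in_image)
      then have "i = k" using rank[OF assms(3,4) i] rank[OF assms(5,6) k(1)] by simp
      then show ?thesis using k by simp
    qed
  qed
qed

text \<open>Taking ranks is strictly monotone from \<open>R\<close> to \<open><\<close>, hence an
  injective self-map of \<open>{1..n}\<close>; its inverse lists the elements in increasing
  order.\<close>

lemma sorts_exists:
  fixes R :: "nat \<Rightarrow> nat \<Rightarrow> bool"
  assumes "transp R" "irreflp R" "totalp R"
  shows "\<exists>\<sigma>. \<sigma> permutes {1..n} \<and> sorts R n \<sigma>"
proof -
  \<comment> \<open>Points outside \<open>{1..n}\<close> are fixed, as \<open>permutes\<close>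
    demands.\<close>
  define r where "r j = (if j \<in> {1..n} then card {k\<in>{1..n}. k = j \<or> R k j} else j)" for j
  have mono: "r j < r k" if "j \<in> {1..n}" "k \<in> {1..n}" "R j k" for j k
  proof -
    have "{i\<in>{1..n}. i = j \<or> R i j} \<subseteq> {i\<in>{1..n}. i = k \<or> R i k}"
      using transpD[OF assms(1) _ that(3)] that(3) by blast
    moreover have "k \<notin> {i\<in>{1..n}. i = j \<or> R i j}"
      using transpD[OF assms(1) that(3), of j] that(3) irreflpD[OF assms(2), of j] by blast
    ultimately have "{i\<in>{1..n}. i = j \<or> R i j} \<subset> {i\<in>{1..n}. i = k \<or> R i k}"
      using that(2) by blast
    then show ?thesis using that by (simp add: r_def psubset_card_mono)
  qed
  have "inj_on r {1..n}"
    by (rule inj_onI) (metis assms(3) mono nat_less_le totalpD)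
  moreover have "r ` {1..n} \<subseteq> {1..n}"
  proof
    fix x assume "x \<in> r ` {1..n}"
    then obtain j where j: "j \<in> {1..n}" "x = r j" by auto
    have "{k\<in>{1..n}. k = j \<or> R k j} \<noteq> {}" using j by auto
    then have "card {k\<in>{1..n}. k = j \<or> R k j} \<ge> 1" by (simp add: Suc_le_eq card_gt_0_iff)
    moreover have "card {k\<in>{1..n}. k = j \<or> R k j} \<le> card {1..n}" by (rule card_mono) auto
    ultimately show "x \<in> {1..n}" using j by (simp add: r_def)
  qed
  ultimately have "bij_betw r {1..n} {1..n}"
    by (simp add: bij_betw_def endo_inj_surj)
  then have r: "r permutes {1..n}"
    by (rule bij_imp_permutes) (metis r_def)
  have "sorts R n (inv r)"
    unfolding sorts_def
  proof (intro ballI impI)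
    fix i j assume ij: "i \<in> {1..n}" "j \<in> {1..n}" "i < j"
    have in': "inv r i \<in> {1..n}" "inv r j \<in> {1..n}"
      using ij permutes_in_image[OF permutes_inv[OF r]] by blast+
    have rr: "r (inv r i) = i" "r (inv r j) = j"
      using r by (simp_all add: permutes_inverses)
    then have "inv r i \<noteq> inv r j" using ij by auto
    then show "R (inv r i) (inv r j)"
      using mono[OF in'(2,1)] rr ij(3) assms(3) by (metis not_less_iff_gr_or_eq totalpD)
  qed
  then show ?thesis using permutes_inv[OF r] by blast
qed

section \<open>Shuffles by zigzag maps and their composition\<close>

text \<open>Label \<open>l\<close> stands for the \<open>l\<close>-th branch of the zigzag map: increasing when \<open>even l = e\<close>, decreasing
  otherwise. Cards with equal labels keep or reverse their order accordingly.\<close>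

definition zigzag_less :: "bool \<Rightarrow> (nat \<Rightarrow> nat) \<Rightarrow> nat \<Rightarrow> nat \<Rightarrow> bool" where
  "zigzag_less e w i j \<longleftrightarrow>
     w i < w j \<or> w i = w j \<and> (if even (w i) = e then i < j else j < i)"

lemma zigzag_less_order:
  "transp (zigzag_less e w)" "irreflp (zigzag_less e w)" "totalp (zigzag_less e w)"
  by (auto simp: transp_def irreflp_def totalp_on_def zigzag_less_def split: if_splits)

definition zigzag_sort :: "nat \<Rightarrow> bool \<Rightarrow> (nat \<Rightarrow> nat) \<Rightarrow> nat \<Rightarrow> nat" where
  "zigzag_sort n e w = (THE \<sigma>. \<sigma> permutes {1..n} \<and> sorts (zigzag_less e w) n \<sigma>)"

lemma zigzag_sort_eq_iff:
  "zigzag_sort n e w = \<sigma> \<longleftrightarrow> \<sigma> permutes {1..n} \<and> sorts (zigzag_less e w) n \<sigma>"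
proof -
  let ?P = "\<lambda>\<sigma>. \<sigma> permutes {1..n} \<and> sorts (zigzag_less e w) n \<sigma>"
  have "\<exists>!\<sigma>. ?P \<sigma>"
    using sorts_exists[OF zigzag_less_order] sorts_unique[OF zigzag_less_order(1,2)] by blast
  from theI'[OF this] show ?thesis
    unfolding zigzag_sort_def using \<open>\<exists>!\<sigma>. ?P \<sigma>\<close> by blast
qed

lemma zigzag_sort_permutes: "zigzag_sort n e w permutes {1..n}"
  using zigzag_sort_eq_iff by blast

lemma sorts_zigzag_sort: "sorts (zigzag_less e w) n (zigzag_sort n e w)"
  using zigzag_sort_eq_iff by blast

text \<open>A two-digit number in base \<open>b\<close> with leading digit \<open>u j\<close>; the
  trailing digit is complemented exactly on the decreasing branches of \<open>u\<close>. The
  restriction to \<open>{1..n}\<close> makes the result extensional, as membership in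
  \<open>words\<close> demands.\<close>

definition merge_words :: "nat \<Rightarrow> nat \<Rightarrow> bool \<Rightarrow> (nat \<Rightarrow> nat) \<Rightarrow> (nat \<Rightarrow> nat) \<Rightarrow> nat \<Rightarrow> nat" where
  "merge_words n b e u w =
     (\<lambda>j\<in>{1..n}. b * u j + (if even (u j) = e then w j else b - 1 - w j))"

abbreviation words :: "nat \<Rightarrow> nat \<Rightarrow> (nat \<Rightarrow> nat) set" where
  "words n a \<equiv> {1..n} \<rightarrow>\<^sub>E {..<a}"

text \<open>The composite of zigzag maps with \<open>a\<close> and \<open>b\<close> branches is a zigzag map with \<open>a * b\<close> branches, whose
  branches inside a decreasing branch of the map applied first are numbered backwards.\<close>

lemma zigzag_sort_comp:
  fixes e e' :: bool
  assumes "w' \<in> words n b"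
  defines "\<tau> \<equiv> zigzag_sort n e' w'"
  shows "\<tau> \<circ> zigzag_sort n e (u \<circ> \<tau>) =
    zigzag_sort n (e' = (even b \<or> e)) (merge_words n b e u w')"
proof -
  let ?\<sigma> = "zigzag_sort n e (u \<circ> \<tau>)"
  \<comment> \<open>Branch 0 of the composite rises iff \<open>?E\<close>. For \<open>e\<close> it
    has the direction of branch 0 of \<open>w'\<close>. Otherwise it is branch \<open>b - 1\<close>
    of \<open>w'\<close> reversed, which rises iff \<open>e'\<close> for even \<open>b\<close> and
    iff not \<open>e'\<close> for odd \<open>b\<close>.\<close>
  let ?E = "e' = (even b \<or> e)"
  let ?W = "merge_words n b e u w'"
  have \<tau>: "\<tau> permutes {1..n}" and \<sigma>: "?\<sigma> permutes {1..n}"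
    unfolding \<tau>_def by (rule zigzag_sort_permutes)+
  have "sorts (zigzag_less ?E ?W) n (\<tau> \<circ> ?\<sigma>)"
    unfolding sorts_def
  proof (intro ballI impI)
    fix i k assume ik: "i \<in> {1..n}" "k \<in> {1..n}" "i < k"
    have \<sigma>in: "?\<sigma> i \<in> {1..n}" "?\<sigma> k \<in> {1..n}"
      using ik permutes_in_image[OF \<sigma>] by blast+
    \<comment> \<open>\<open>p\<close> and \<open>q\<close> are the cards at places \<open>i\<close>
      and \<open>k\<close> of the composite. As \<open>u\<close> labels cards,
      \<open>u \<circ> \<tau>\<close> shows at place \<open>?\<sigma> i\<close> the label of
      \<open>p\<close>.\<close>
    define p where "p = \<tau> (?\<sigma> i)"
    define q where "q = \<tau> (?\<sigma> k)"
    have pq: "p \<in> {1..n}" "q \<in> {1..n}"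
      using \<sigma>in permutes_in_image[OF \<tau>] unfolding p_def q_def by blast+
    have Wp: "?W p = b * u p + (if even (u p) = e then w' p else b - 1 - w' p)"
      and Wq: "?W q = b * u q + (if even (u q) = e then w' q else b - 1 - w' q)"
      using pq by (simp_all add: merge_words_def)
    have b: "w' p < b" "w' q < b" using assms(1) pq by (auto simp: PiE_iff)
    have less: "zigzag_less e (u \<circ> \<tau>) (?\<sigma> i) (?\<sigma> k)"
      using sorts_zigzag_sort ik unfolding sorts_def by blast
    have \<tau>less: "zigzag_less e' w' (\<tau> x) (\<tau> y)" if "x \<in> {1..n}" "y \<in> {1..n}" "x < y" for x y
      using sorts_zigzag_sort that unfolding sorts_def \<tau>_def by blast
    consider "u p < u q" | "u p = u q" "even (u p) = e" "?\<sigma> i < ?\<sigma> k"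
      | "u p = u q" "even (u p) \<noteq> e" "?\<sigma> k < ?\<sigma> i"
      using less by (auto simp: zigzag_less_def p_def q_def split: if_splits)
    then have "zigzag_less ?E ?W p q"
    proof cases
      case 1
      have "?W p < b * u p + b" unfolding Wp using b by auto
      also have "\<dots> \<le> b * u q" using 1 by (metis Suc_leI add.commute mult_Suc_right mult_le_mono2)
      also have "\<dots> \<le> ?W q" unfolding Wq by simp
      finally show ?thesis by (simp add: zigzag_less_def)
    next
      case 2
      have "zigzag_less e' w' p q" using \<tau>less[OF \<sigma>in 2(3)] by (simp add: p_def q_def)
      then show ?thesis using 2(1,2) b unfolding zigzag_less_def Wp Wq
        by (auto split: if_splits)
    next
      case 3
      \<comment> \<open>A decreasing branch of \<open>u\<close> reverses the places, so
        \<open>q\<close> comes before \<open>p\<close> in the order of \<open>w'\<close>.\<close>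
      have "zigzag_less e' w' q p" using \<tau>less[OF \<sigma>in(2,1) 3(3)] by (simp add: p_def q_def)
      then consider "w' q < w' p" | "w' q = w' p" "if even (w' q) = e' then q < p else p < q"
        by (auto simp: zigzag_less_def)
      then show ?thesis
      proof cases
        case 1
        then show ?thesis using 3(1,2) b unfolding zigzag_less_def Wp Wq by auto
      next
        case eq: 2
        \<comment> \<open>\<open>r\<close> is the complemented digit \<open>b - 1 - w' p\<close>.
          Expressing \<open>b\<close> through it removes truncated subtraction and yields the parity
          of the composite label.\<close>
        obtain r where r: "b = Suc (w' p + r)"
          using b(1) less_iff_Suc_add by auto
        then have "b - 1 - w' p = r" and parity: "even b \<longleftrightarrow> odd (w' p + r)" by simp_all
        then have W: "?W p = b * u p + r" "?W q = b * u p + r"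
          using Wp Wq 3(1,2) eq(1) by auto
        show ?thesis unfolding zigzag_less_def W using 3(2) eq parity
          by (auto split: if_splits)
      qed
    qed
    then show "zigzag_less ?E ?W ((\<tau> \<circ> ?\<sigma>) i) ((\<tau> \<circ> ?\<sigma>) k)" by (simp add: p_def q_def)
  qed
  moreover have "\<tau> \<circ> ?\<sigma> permutes {1..n}" using \<sigma> \<tau> by (rule permutes_compose)
  ultimately show ?thesis by (metis zigzag_sort_eq_iff)
qed

text \<open>Division with remainder by \<open>b\<close> undoes the merge: the quotient is
  \<open>u j\<close>, its parity tells whether the remainder was complemented, and complementing is
  an involution.\<close>

lemma bij_betw_merge_words:
  "bij_betw (\<lambda>(u, w). merge_words n b e u w) (words n a \<times> words n b) (words n (a * b))"
proof (rule bij_betw_byWitness)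
  define flip where "flip c r = (if even c = e then r else b - 1 - r)" for c r :: nat
  have flip_less: "flip c r < b" and flip_flip: "flip c (flip c r) = r" if "r < b" for c r
    using that by (auto simp: flip_def)
  have merge: "merge_words n b e u w j = b * u j + flip (u j) (w j)" if "j \<in> {1..n}" for u w j
    using that by (simp add: merge_words_def flip_def)
  let ?q = "\<lambda>W. \<lambda>j\<in>{1..n}. W j div b"
  let ?r = "\<lambda>W. \<lambda>j\<in>{1..n}. flip (W j div b) (W j mod b)"
  have less: "b * x + y < a * b" if "x < a" "y < b" for x y :: nat
  proof -
    have "b * x + y < b * Suc x" using that by simp
    also have "\<dots> \<le> b * a" using that by (intro mult_le_mono2) simp
    finally show ?thesis by (simp add: mult.commute)
  qed
  show "\<forall>p\<in>words n a \<times> words n b.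
      (\<lambda>W. (?q W, ?r W)) (case p of (u, w) \<Rightarrow> merge_words n b e u w) = p"
  proof clarify
    fix u w assume uw: "u \<in> words n a" "w \<in> words n b"
    let ?W = "merge_words n b e u w"
    have lt: "w j < b" if "j \<in> {1..n}" for j using that uw by (auto simp: PiE_iff)
    have div: "?W j div b = u j" if "j \<in> {1..n}" for j
      using flip_less[OF lt[OF that], of "u j"] by (simp only: merge[OF that]) simp
    have mod: "?W j mod b = flip (u j) (w j)" if "j \<in> {1..n}" for j
      using flip_less[OF lt[OF that], of "u j"] by (simp only: merge[OF that]) simp
    have "?q ?W j = u j \<and> ?r ?W j = w j" for j
    proof (cases "j \<in> {1..n}")
      case True
      then show ?thesis
        using div[OF True] mod[OF True] flip_flip[OF lt[OF True]] by (simp only: restrict_apply')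
    next
      case False
      then show ?thesis using uw[THEN PiE_arb[OF _ False]] by (simp only: restrict_def if_False)
    qed
    then show "?q ?W = u \<and> ?r ?W = w" by blast
  qed
  show "\<forall>W\<in>words n (a * b). (case (?q W, ?r W) of (u, w) \<Rightarrow> merge_words n b e u w) = W"
  proof
    fix W assume W: "W \<in> words n (a * b)"
    have "merge_words n b e (?q W) (?r W) j = W j" for j
    proof (cases "j \<in> {1..n}")
      case True
      then have "W j < a * b" using W by (auto simp: PiE_iff)
      \<comment> \<open>\<open>b = 0\<close> would contradict \<open>W j < a * b\<close>.\<close>
      then have "W j mod b < b" by (cases "b = 0") auto
      then show ?thesis unfolding merge[OF True] using True by (simp add: flip_flip)
    next
      case False
      then show ?thesis using PiE_arb[OF W False] by (simp only: merge_words_def restrict_def if_False)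
    qed
    then show "(case (?q W, ?r W) of (u, w) \<Rightarrow> merge_words n b e u w) = W" by auto
  qed
  show "(\<lambda>(u, w). merge_words n b e u w) ` (words n a \<times> words n b) \<subseteq> words n (a * b)"
  proof clarify
    fix u w assume uw: "u \<in> words n a" "w \<in> words n b"
    show "merge_words n b e u w \<in> words n (a * b)"
    proof (rule PiE_I)
      fix j assume j: "j \<in> {1..n}"
      then have "u j < a" "w j < b" using uw by (auto simp: PiE_iff)
      then show "merge_words n b e u w j \<in> {..<a * b}"
        unfolding merge[OF j] by (simp add: less flip_less)
    qed (auto simp: merge_words_def)
  qed
  show "(\<lambda>W. (?q W, ?r W)) ` words n (a * b) \<subseteq> words n a \<times> words n b"
  proof (clarify, intro conjI)
    fix W assume W: "W \<in> words n (a * b)"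
    have lt: "W j < a * b" if "j \<in> {1..n}" for j using that W by (auto simp: PiE_iff)
    then have "W j mod b < b" if "j \<in> {1..n}" for j using lt[OF that] by (cases "b = 0") auto
    then show "?r W \<in> words n b" by (intro restrict_PiE_iff[THEN iffD2]) (simp add: flip_less)
    show "?q W \<in> words n a"
      using lt by (auto simp: less_mult_imp_div_less)
  qed
qed

section \<open>The zigzag sums H_a, bilinearity, and the product H_a H_b\<close>

definition zigzag_sum :: "nat \<Rightarrow> nat \<Rightarrow> perm_comb" where
  "zigzag_sum n a =
     (\<Sum>e\<in>(UNIV :: bool set). \<Sum>w\<in>words n a. Poly_Mapping.single (zigzag_sort n e w) 1)"

lemma finite_words: "finite (words n a)"
  by (simp add: finite_PiE)

text \<open>Enlarging the supports only adds zero terms. Common index sets reduce bilinearity to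
  distributing sums, even where keys of a sum cancel.\<close>

lemma gmult_eq_sum:
  assumes "finite X" "finite Y" "Poly_Mapping.keys x \<subseteq> X" "Poly_Mapping.keys y \<subseteq> Y"
  shows "x \<odot> y = (\<Sum>\<sigma>\<in>X. \<Sum>\<tau>\<in>Y.
    Poly_Mapping.single (\<tau> \<circ> \<sigma>) (Poly_Mapping.lookup x \<sigma> * Poly_Mapping.lookup y \<tau>))"
  unfolding gmult_def
  using assms
  by (intro sum.mono_neutral_cong_left sum.mono_neutral_left ballI)
    (auto simp: in_keys_iff intro!: sum.neutral)

lemma gmult_add_left: "(x + y) \<odot> z = x \<odot> z + y \<odot> z"
proof -
  let ?X = "Poly_Mapping.keys x \<union> Poly_Mapping.keys y"
  have "Poly_Mapping.keys (x + y) \<subseteq> ?X" by (rule keys_add)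
  then show ?thesis
    by (simp add: gmult_eq_sum[of ?X "Poly_Mapping.keys z"] lookup_add algebra_simps single_add
        sum.distrib)
qed

lemma gmult_add_right: "z \<odot> (x + y) = z \<odot> x + z \<odot> y"
proof -
  let ?X = "Poly_Mapping.keys x \<union> Poly_Mapping.keys y"
  have "Poly_Mapping.keys (x + y) \<subseteq> ?X" by (rule keys_add)
  then show ?thesis
    by (simp add: gmult_eq_sum[of "Poly_Mapping.keys z" ?X] lookup_add algebra_simps single_add
        sum.distrib)
qed

lemma qscale_single: "qscale c (Poly_Mapping.single \<sigma> a) = Poly_Mapping.single \<sigma> (c * a)"
  by (rule poly_mapping_eqI) (simp add: lookup_qscale lookup_single when_def)

lemma keys_qscale: "Poly_Mapping.keys (qscale c x) \<subseteq> Poly_Mapping.keys x"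
  by (auto simp: in_keys_iff lookup_qscale)

lemma gmult_qscale_left: "qscale c x \<odot> y = qscale c (x \<odot> y)"
  using keys_qscale[of c x]
  by (simp add: gmult_eq_sum[of "Poly_Mapping.keys x" "Poly_Mapping.keys y"] lookup_qscale
      QG.scale_sum_right qscale_single mult.assoc)

lemma gmult_qscale_right: "x \<odot> qscale c y = qscale c (x \<odot> y)"
  using keys_qscale[of c y]
  by (simp add: gmult_eq_sum[of "Poly_Mapping.keys x" "Poly_Mapping.keys y"] lookup_qscale
      QG.scale_sum_right qscale_single mult.left_commute)

lemma gmult_zero: "0 \<odot> x = 0" "x \<odot> 0 = 0"
  by (simp_all add: gmult_def)

lemma gmult_sum_left: "sum f A \<odot> y = (\<Sum>a\<in>A. f a \<odot> y)"
  by (induction A rule: infinite_finite_induct) (simp_all add: gmult_zero gmult_add_left)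

lemma gmult_sum_right: "y \<odot> sum f A = (\<Sum>a\<in>A. y \<odot> f a)"
  by (induction A rule: infinite_finite_induct) (simp_all add: gmult_zero gmult_add_right)

lemma compose_words:
  assumes "w \<in> {1..n} \<rightarrow>\<^sub>E X" "\<rho> permutes {1..n}"
  shows "w \<circ> \<rho> \<in> {1..n} \<rightarrow>\<^sub>E X"
proof (rule PiE_I)
  fix j assume "j \<in> {1..n}"
  then have "\<rho> j \<in> {1..n}" using assms(2) by (metis permutes_in_image)
  then show "(w \<circ> \<rho>) j \<in> X" using assms(1) by (auto simp: PiE_iff)
next
  fix j assume "j \<notin> {1..n}"
  then show "(w \<circ> \<rho>) j = undefined"
    using assms(2) PiE_arb[OF assms(1)] by (metis comp_apply permutes_not_in)
qed

text \<open>For fixed \<open>w'\<close>, the word of the first factor is written as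
  \<open>u \<circ> \<tau>\<close>; then \<open>zigzag_sort_comp\<close> applies, and the pairs
  \<open>(u, w')\<close> merge bijectively into words over \<open>a * b\<close> labels. For each
  fixed \<open>e\<close> the resulting orientation runs through both truth values as
  \<open>e'\<close> does, so the two values of \<open>e\<close> give the factor 2.\<close>

lemma zigzag_sum_gmult:
  "zigzag_sum n a \<odot> zigzag_sum n b = qscale 2 (zigzag_sum n (a * b))"
proof -
  let ?s = "\<lambda>\<sigma>. Poly_Mapping.single \<sigma> (1 :: rat)"
  have shift: "(\<Sum>w\<in>words n a. ?s (zigzag_sort n e' w' \<circ> zigzag_sort n e w)) =
      (\<Sum>u\<in>words n a. ?s (zigzag_sort n (e' = (even b \<or> e)) (merge_words n b e u w')))"
    if w': "w' \<in> words n b" for e e' w'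
  proof -
    define \<tau> where "\<tau> = zigzag_sort n e' w'"
    have \<tau>: "\<tau> permutes {1..n}" unfolding \<tau>_def by (rule zigzag_sort_permutes)
    have "(\<Sum>w\<in>words n a. ?s (\<tau> \<circ> zigzag_sort n e w)) =
        (\<Sum>u\<in>words n a. ?s (\<tau> \<circ> zigzag_sort n e (u \<circ> \<tau>)))"
      by (rule sum.reindex_bij_witness[of _ "\<lambda>u. u \<circ> \<tau>" "\<lambda>w. w \<circ> inv \<tau>"])
        (simp_all only: compose_words \<tau> permutes_inv comp_assoc permutes_inv_o[OF \<tau>] comp_id)
    also have "\<dots> =
        (\<Sum>u\<in>words n a. ?s (zigzag_sort n (e' = (even b \<or> e)) (merge_words n b e u w')))"
      unfolding \<tau>_def by (intro sum.cong refl arg_cong[where f = ?s] zigzag_sort_comp w')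
    finally show ?thesis unfolding \<tau>_def .
  qed
  have "zigzag_sum n a \<odot> zigzag_sum n b =
      (\<Sum>e\<in>UNIV. \<Sum>w\<in>words n a. \<Sum>e'\<in>UNIV. \<Sum>w'\<in>words n b.
        ?s (zigzag_sort n e' w' \<circ> zigzag_sort n e w))"
    unfolding zigzag_sum_def gmult_sum_left
    by (simp only: gmult_sum_right gmult_single mult_1)
  also have "\<dots> = (\<Sum>e\<in>UNIV. \<Sum>e'\<in>UNIV. \<Sum>w'\<in>words n b. \<Sum>w\<in>words n a.
        ?s (zigzag_sort n e' w' \<circ> zigzag_sort n e w))"
    by (intro sum.cong refl) (simp only: sum.swap[of _ "words n a"])
  also have "\<dots> = (\<Sum>e\<in>UNIV. \<Sum>e'\<in>UNIV. \<Sum>w'\<in>words n b. \<Sum>u\<in>words n a.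
        ?s (zigzag_sort n (e' = (even b \<or> e)) (merge_words n b e u w')))"
    by (intro sum.cong refl shift)
  also have "\<dots> = (\<Sum>e\<in>UNIV. \<Sum>e'\<in>UNIV. \<Sum>W\<in>words n (a * b).
        ?s (zigzag_sort n (e' = (even b \<or> e)) W))"
  proof (rule sum.cong[OF refl], rule sum.cong[OF refl])
    fix e e' :: bool
    let ?f = "\<lambda>W. ?s (zigzag_sort n (e' = (even b \<or> e)) W)"
    have "(\<Sum>w'\<in>words n b. \<Sum>u\<in>words n a. ?f (merge_words n b e u w')) =
        (\<Sum>p\<in>words n a \<times> words n b. ?f (case p of (u, w) \<Rightarrow> merge_words n b e u w))"
      by (subst sum.swap) (simp add: sum.cartesian_product case_prod_unfold)
    also have "\<dots> = (\<Sum>W\<in>words n (a * b). ?f W)"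
      by (rule sum.reindex_bij_betw[OF bij_betw_merge_words])
    finally show "(\<Sum>w'\<in>words n b. \<Sum>u\<in>words n a. ?f (merge_words n b e u w')) =
        (\<Sum>W\<in>words n (a * b). ?f W)" .
  qed
  also have "\<dots> = (\<Sum>e\<in>(UNIV :: bool set). zigzag_sum n (a * b))"
    unfolding zigzag_sum_def
  proof (rule sum.cong[OF refl])
    fix e :: bool
    show "(\<Sum>e'\<in>UNIV. \<Sum>W\<in>words n (a * b). ?s (zigzag_sort n (e' = (even b \<or> e)) W)) =
        (\<Sum>E\<in>UNIV. \<Sum>W\<in>words n (a * b). ?s (zigzag_sort n E W))"
      by (cases "even b \<or> e") (simp_all add: UNIV_bool add.commute)
  qed
  also have "\<dots> = qscale 2 (zigzag_sum n (a * b))"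
    by (rule poly_mapping_eqI) (simp add: lookup_qscale UNIV_bool lookup_add)
  finally show ?thesis .
qed

section \<open>Counting label sequences by their last label\<close>

text \<open>\<open>d\<close> tells whether two consecutive cards ascend; they may share a branch
  only if its direction agrees with \<open>d\<close>.\<close>

definition step_ok :: "bool \<Rightarrow> bool \<Rightarrow> nat \<Rightarrow> nat \<Rightarrow> bool" where
  "step_ok e d x y \<longleftrightarrow> x < y \<or> x = y \<and> (even x = e) = d"

text \<open>The transfer recursion for the size of \<open>monotone_words\<close>. The last of
  \<open>Suc (Suc m)\<close> letters is reached by step number \<open>Suc m\<close>.\<close>

fun count_words :: "(nat \<Rightarrow> bool) \<Rightarrow> bool \<Rightarrow> nat \<Rightarrow> nat \<Rightarrow> nat" where
  "count_words d e 0 k = 1"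
| "count_words d e (Suc 0) k = 1"
| "count_words d e (Suc (Suc m)) k =
     (\<Sum>j | step_ok e (d (Suc m)) j k. count_words d e (Suc m) j)"

definition monotone_words :: "(nat \<Rightarrow> bool) \<Rightarrow> bool \<Rightarrow> nat \<Rightarrow> nat \<Rightarrow> (nat \<Rightarrow> nat) set" where
  "monotone_words d e m k =
     {v \<in> {1..m} \<rightarrow>\<^sub>E UNIV. v m = k \<and> (\<forall>i\<in>{1..<m}. step_ok e (d i) (v i) (v (Suc i)))}"

lemma finite_step_ok: "finite {j. step_ok e d j k}"
  by (rule finite_subset[of _ "{..k}"]) (auto simp: step_ok_def)

lemma monotone_words_Suc:
  assumes "m \<ge> 1"
  shows "bij_betw (\<lambda>(j, v). v(Suc m := k))
    (SIGMA j:{j. step_ok e (d m) j k}. monotone_words d e m j) (monotone_words d e (Suc m) k)"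
\<comment> \<open>Deleting the last label resets it to \<open>undefined\<close>, because the shorter
  words are extensional on \<open>{1..m}\<close>.\<close>
proof (rule bij_betw_byWitness[where f' = "\<lambda>v. (v m, v(Suc m := undefined))"])
  have Suc: "{1..Suc m} = insert (Suc m) {1..m}" "{1..<Suc m} = insert m {1..<m}"
    using assms by auto
  show "(\<lambda>(j, v). v(Suc m := k)) ` (SIGMA j:{j. step_ok e (d m) j k}. monotone_words d e m j)
      \<subseteq> monotone_words d e (Suc m) k"
    unfolding monotone_words_def Suc by (auto simp: PiE_iff extensional_def)
  show "(\<lambda>v. (v m, v(Suc m := undefined))) ` monotone_words d e (Suc m) k
      \<subseteq> (SIGMA j:{j. step_ok e (d m) j k}. monotone_words d e m j)"
    unfolding monotone_words_def Suc by (auto simp: PiE_iff extensional_def)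
qed (auto simp: monotone_words_def PiE_iff extensional_def fun_eq_iff)

lemma card_monotone_words:
  assumes "m \<ge> 1"
  shows "finite (monotone_words d e m k) \<and> card (monotone_words d e m k) = count_words d e m k"
  using assms
proof (induction m arbitrary: k rule: nat_induct_at_least)
  case base
  have "monotone_words d e 1 k = {\<lambda>i\<in>{1}. k}"
    by (auto simp: monotone_words_def PiE_iff extensional_def fun_eq_iff)
  then show ?case by simp
next
  case (Suc m)
  let ?J = "{j. step_ok e (d m) j k}"
  have bij: "bij_betw (\<lambda>(j, v). v(Suc m := k)) (SIGMA j:?J. monotone_words d e m j)
      (monotone_words d e (Suc m) k)"
    by (rule monotone_words_Suc[OF Suc.hyps])
  have fin: "finite (SIGMA j:?J. monotone_words d e m j)"
    using Suc.IH finite_step_ok by blast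
  have "card (SIGMA j:?J. monotone_words d e m j) = (\<Sum>j\<in>?J. count_words d e m j)"
    using Suc.IH finite_step_ok by (subst card_SigmaI) auto
  then have "card (monotone_words d e (Suc m) k) = (\<Sum>j\<in>?J. count_words d e m j)"
    using bij_betw_same_card[OF bij] by simp
  moreover obtain m' where "m = Suc m'" using Suc.hyps by (cases m) auto
  ultimately show ?case using bij_betw_finite[OF bij] fin by simp
qed

section \<open>Generating functions in the last label\<close>

text \<open>The orientation \<open>e\<close> is recovered from the last label \<open>k\<close> and the direction \<open>p\<close> of that label.
  Fixing \<open>p\<close> rather than \<open>e\<close> makes the recursion below a product of generating functions.\<close>

definition level_fps :: "(nat \<Rightarrow> bool) \<Rightarrow> nat \<Rightarrow> bool \<Rightarrow> rat fps" where
  "level_fps d m p = Abs_fps (\<lambda>k. of_nat (count_words d (even k = p) m k))"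

text \<open>A last label \<open>k\<close> of direction \<open>d m\<close> may follow any label up to
  \<open>k\<close>, one of the opposite direction only smaller labels. For fixed \<open>e\<close>,
  moving \<open>k\<close> by one flips its direction, so the opposite series is a shift by
  \<open>fps_X\<close>. Subtracting the sum for \<open>k - 2\<close> from that for \<open>k\<close>
  leaves the terms at \<open>k\<close> and \<open>k - 1\<close>, whose directions are
  \<open>d m\<close> and \<open>\<not> d m\<close>.\<close>

lemma level_fps_Suc:
  assumes "m \<ge> 1"
  shows "(1 - fps_X ^ 2) * level_fps d (Suc m) (d m) =
      level_fps d m (d m) + fps_X * level_fps d m (\<not> d m)"
    and "level_fps d (Suc m) (\<not> d m) = fps_X * level_fps d (Suc m) (d m)"
proof -
  obtain m' where m: "m = Suc m'" using assms by (cases m) auto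
  define c where "c e k = count_words d e m k" for e k
  have up: "count_words d (even k = d m) (Suc m) k = (\<Sum>j\<le>k. c (even k = d m) j)" for k
  proof -
    have "{j. step_ok (even k = d m) (d m) j k} = {..k}" by (auto simp: step_ok_def)
    then show ?thesis by (simp add: m c_def)
  qed
  have down: "count_words d (even k = (\<not> d m)) (Suc m) k = (\<Sum>j<k. c (even k = (\<not> d m)) j)" for k
  proof -
    have "{j. step_ok (even k = (\<not> d m)) (d m) j k} = {..<k}" by (auto simp: step_ok_def)
    then show ?thesis by (simp add: m c_def)
  qed
  show "level_fps d (Suc m) (\<not> d m) = fps_X * level_fps d (Suc m) (d m)"
  proof (rule fps_ext)
    fix k
    show "fps_nth (level_fps d (Suc m) (\<not> d m)) k =
        fps_nth (fps_X * level_fps d (Suc m) (d m)) k"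
    proof (cases k)
      case 0
      then show ?thesis using down[of 0] by (simp add: level_fps_def)
    next
      case (Suc l)
      have "(even (Suc l) = (\<not> d m)) = (even l = d m)" by auto
      then have "count_words d (even k = (\<not> d m)) (Suc m) k =
          count_words d (even l = d m) (Suc m) l"
        unfolding down up Suc by (simp only: lessThan_Suc_atMost)
      then show ?thesis by (simp add: level_fps_def Suc)
    qed
  qed
  show "(1 - fps_X ^ 2) * level_fps d (Suc m) (d m) =
      level_fps d m (d m) + fps_X * level_fps d m (\<not> d m)"
  proof (rule fps_ext)
    fix k
    have lhs: "fps_nth ((1 - fps_X ^ 2) * level_fps d (Suc m) (d m)) k =
        of_nat (\<Sum>j\<le>k. c (even k = d m) j) -
        (if k < 2 then 0 else of_nat (\<Sum>j\<le>k - 2. c (even (k - 2) = d m) j))"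
      unfolding level_fps_def
      by (simp only: left_diff_distrib mult_1 fps_sub_nth fps_X_power_mult_nth fps_nth_Abs_fps up)
    have rhs: "fps_nth (level_fps d m (d m) + fps_X * level_fps d m (\<not> d m)) k =
        of_nat (c (even k = d m) k) +
        (if k = 0 then 0 else of_nat (c (even (k - 1) = (\<not> d m)) (k - 1)))"
      unfolding level_fps_def c_def by simp
    consider "k = 0" | "k = 1" | l where "k = Suc (Suc l)"
      by (metis One_nat_def not0_implies_Suc)
    then show "fps_nth ((1 - fps_X ^ 2) * level_fps d (Suc m) (d m)) k =
        fps_nth (level_fps d m (d m) + fps_X * level_fps d m (\<not> d m)) k"
    proof cases
      case 3
      have "(even (Suc l) = (\<not> d m)) = (even l = d m)" by auto
      then show ?thesis unfolding lhs rhs by (simp add: 3)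
    qed (unfold lhs rhs, simp_all)
  qed
qed

definition turns :: "(nat \<Rightarrow> bool) \<Rightarrow> nat \<Rightarrow> nat" where
  "turns d m = card {i. 1 < i \<and> i < m \<and> d (i - 1) \<noteq> d i}"

lemma turns_Suc:
  assumes "m \<ge> 2"
  shows "turns d (Suc m) = (if d (m - 1) = d m then turns d m else Suc (turns d m))"
proof -
  let ?S = "\<lambda>m. {i. 1 < i \<and> i < m \<and> d (i - 1) \<noteq> d i}"
  have "?S (Suc m) = (if d (m - 1) = d m then ?S m else insert m (?S m))"
    using assms by (auto simp: less_Suc_eq)
  moreover have "finite (?S m)" by simp
  ultimately show ?thesis by (simp add: turns_def)
qed

text \<open>The first label contributes 1 / (1 - X), the first step (1 + X) / (1 - X^2), each of the
  \<open>m - 2\<close> further steps (1 + X^2) / (1 - X^2); the last factor replaces 1 + X^2 by 2 X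
  at each of \<open>t\<close> turns.\<close>

definition turn_fps :: "nat \<Rightarrow> nat \<Rightarrow> rat fps" where
  "turn_fps m t = Abs_fps (\<lambda>_. 1) * (1 + fps_X) * inverse (1 - fps_X ^ 2) *
     ((1 + fps_X ^ 2) * inverse (1 - fps_X ^ 2)) ^ (m - 2) *
     (2 * fps_X * inverse (1 + fps_X ^ 2)) ^ t"

lemma eq_inverse_one_minus_X2_mult:
  fixes f g :: "rat fps"
  assumes "(1 - fps_X ^ 2) * f = g"
  shows "f = inverse (1 - fps_X ^ 2) * g"
proof -
  have "inverse (1 - fps_X ^ 2) * (1 - fps_X ^ 2) = (1 :: rat fps)"
    by (rule inverse_mult_eq_1) simp
  then show ?thesis unfolding assms[symmetric] mult.assoc[symmetric] by simp
qed

lemma inverse_one_plus_X2: "inverse (1 + fps_X ^ 2) * (1 + fps_X ^ 2) = (1 :: rat fps)"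
  by (rule inverse_mult_eq_1) simp

text \<open>Let Y be the series for direction \<open>d (m - 1)\<close>; the opposite one is X Y. The
  next step forms Y + X (X Y) = (1 + X^2) Y if the direction persists, and X Y + X Y = 2 X Y if it
  turns.\<close>

lemma level_fps_eq_turn_fps:
  assumes "m \<ge> 2"
  shows "level_fps d m (d (m - 1)) = turn_fps m (turns d m)"
    "level_fps d m (\<not> d (m - 1)) = fps_X * turn_fps m (turns d m)"
proof -
  have "level_fps d m (d (m - 1)) = turn_fps m (turns d m)"
    using assms
  proof (induction m rule: nat_induct_at_least)
    case base
    have "level_fps d 1 p = Abs_fps (\<lambda>_. 1)" for p
      by (rule fps_ext) (simp add: level_fps_def)
    moreover have "(2 :: nat) = Suc 1" by simp
    ultimately have "(1 - fps_X ^ 2) * level_fps d 2 (d 1) = (1 + fps_X) * Abs_fps (\<lambda>_. 1)"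
      using level_fps_Suc(1)[of 1 d] by (simp only: distrib_right mult_1 order.refl)
    then have "level_fps d 2 (d 1) = inverse (1 - fps_X ^ 2) * ((1 + fps_X) * Abs_fps (\<lambda>_. 1))"
      by (rule eq_inverse_one_minus_X2_mult)
    moreover have "turns d 2 = 0" by (auto simp: turns_def)
    ultimately show ?case by (simp add: turn_fps_def ac_simps)
  next
    case (Suc m)
    let ?Y = "turn_fps m (turns d m)"
    have step: "level_fps d (Suc m) (d m) =
        inverse (1 - fps_X ^ 2) * (level_fps d m (d m) + fps_X * level_fps d m (\<not> d m))"
      using Suc.hyps by (intro eq_inverse_one_minus_X2_mult level_fps_Suc(1)) simp
    have other: "level_fps d m (\<not> d (m - 1)) = fps_X * ?Y"
      using level_fps_Suc(2)[of "m - 1" d] Suc by simp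
    obtain r where r: "m = Suc (Suc r)"
      using Suc.hyps by (metis One_nat_def Suc_1 Suc_le_D Suc_le_mono)
    show ?case
    proof (cases "d (m - 1) = d m")
      case True
      have "level_fps d (Suc m) (d m) = inverse (1 - fps_X ^ 2) * (?Y + fps_X * (fps_X * ?Y))"
        using step Suc.IH other True by simp
      also have "\<dots> = (1 + fps_X ^ 2) * inverse (1 - fps_X ^ 2) * ?Y"
        by (simp add: algebra_simps power2_eq_square)
      also have "\<dots> = turn_fps (Suc m) (turns d m)"
        by (simp add: turn_fps_def r ac_simps)
      finally show ?thesis using True Suc.hyps by (simp add: turns_Suc)
    next
      case False
      then have flip: "(\<not> d (m - 1)) = d m" "(\<not> d m) = d (m - 1)" by auto
      have "level_fps d (Suc m) (d m) = inverse (1 - fps_X ^ 2) * (fps_X * ?Y + fps_X * ?Y)"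
        using step unfolding flip Suc.IH other[unfolded flip] .
      also have "\<dots> = inverse (1 - fps_X ^ 2) * (2 * fps_X) * ?Y"
        by (simp add: algebra_simps)
      \<comment> \<open>\<open>turn_fps\<close> charges 1 + X^2 to every step after the first and
        cancels it at turns, hence this inserted unit.\<close>
      also have "\<dots> = inverse (1 - fps_X ^ 2) * (2 * fps_X) * ?Y *
          (inverse (1 + fps_X ^ 2) * (1 + fps_X ^ 2))"
        by (simp only: inverse_one_plus_X2 mult_1_right)
      also have "\<dots> = turn_fps (Suc m) (Suc (turns d m))"
        by (simp add: turn_fps_def r ac_simps)
      finally show ?thesis using False Suc.hyps by (simp add: turns_Suc)
    qed
  qed
  then show "level_fps d m (d (m - 1)) = turn_fps m (turns d m)"
    "level_fps d m (\<not> d (m - 1)) = fps_X * turn_fps m (turns d m)"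
    using level_fps_Suc(2)[of "m - 1" d] assms by simp_all
qed

text \<open>Each turn carries one factor X, and all other factors have nonzero constant term. This
  is the source of triangularity.\<close>

lemma turn_fps_eq_power_mult:
  "\<exists>u. turn_fps m t = fps_X ^ t * u \<and> fps_nth u 0 \<noteq> 0"
proof (intro exI conjI)
  let ?u = "Abs_fps (\<lambda>_. 1) * (1 + fps_X) * inverse (1 - fps_X ^ 2) *
     ((1 + fps_X ^ 2) * inverse (1 - fps_X ^ 2)) ^ (m - 2) *
     (2 * inverse (1 + fps_X ^ 2)) ^ t :: rat fps"
  show "turn_fps m t = fps_X ^ t * ?u"
    by (simp add: turn_fps_def power_mult_distrib ac_simps)
  show "fps_nth ?u 0 \<noteq> 0"
    by (simp add: fps_mult_nth_0 fps_power_zeroth numeral_fps_const)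
qed

section \<open>Coefficients of the zigzag sums\<close>

text \<open>The values at \<open>n = 1\<close> are set apart because \<^const>\<open>turn_fps\<close> describes words with at least
  one step.\<close>

definition zigzag_coeff :: "nat \<Rightarrow> nat \<Rightarrow> nat \<Rightarrow> rat" where
  "zigzag_coeff n a t = (if n = 1 then (if t = 0 then 2 * of_nat a else 0)
     else \<Sum>k<a. fps_nth ((1 + fps_X) * turn_fps n t) k)"

lemma zigzag_coeff_eq_0:
  assumes "a \<le> t"
  shows "zigzag_coeff n a t = 0"
proof -
  obtain u where u: "turn_fps n t = fps_X ^ t * u" using turn_fps_eq_power_mult by blast
  have "fps_nth ((1 + fps_X) * turn_fps n t) k = 0" if "k < a" for k
  proof -
    have "(1 + fps_X) * turn_fps n t = fps_X ^ t * ((1 + fps_X) * u)"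
      by (simp only: u mult.left_commute)
    then show ?thesis using that assms by (simp only: fps_X_power_mult_nth) simp
  qed
  then show ?thesis using assms by (simp add: zigzag_coeff_def)
qed

text \<open>The diagonal of the triangular system: only degree \<open>t\<close> survives in the sum,
  with the constant term of \<open>u\<close> as its coefficient. For \<open>n = 1\<close> the value
  is 2.\<close>

lemma zigzag_coeff_neq_0:
  assumes "n = 1 \<longrightarrow> t = 0"
  shows "zigzag_coeff n (Suc t) t \<noteq> 0"
proof -
  obtain u where u: "turn_fps n t = fps_X ^ t * u" "fps_nth u 0 \<noteq> 0"
    using turn_fps_eq_power_mult by blast
  have "(1 + fps_X) * turn_fps n t = fps_X ^ t * ((1 + fps_X) * u)"
    by (simp only: u mult.left_commute)
  then have "fps_nth ((1 + fps_X) * turn_fps n t) k = (if k < t then 0 else fps_nth u 0)"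
    if "k \<le> t" for k
    using that by (simp only: fps_X_power_mult_nth) (auto simp: fps_mult_nth_0)
  then have "(\<Sum>k<Suc t. fps_nth ((1 + fps_X) * turn_fps n t) k) =
      (\<Sum>k<Suc t. if k = t then fps_nth u 0 else 0)"
    by (intro sum.cong refl) auto
  then have "(\<Sum>k<Suc t. fps_nth ((1 + fps_X) * turn_fps n t) k) = fps_nth u 0"
    by simp
  then show ?thesis using assms u(2) by (auto simp: zigzag_coeff_def)
qed

text \<open>At a fixed last label the two orientations give the two directions of that label, so
  summing over \<open>e\<close> adds the two level series. For \<open>n \<ge> 2\<close> this is the
  factor 1 + X in \<open>zigzag_coeff\<close>.\<close>

lemma sum_count_words:
  assumes "n \<ge> 1"
  shows "(\<Sum>e\<in>UNIV. \<Sum>k<a. of_nat (count_words d e n k)) = zigzag_coeff n a (turns d n)"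
proof -
  have "(\<Sum>e\<in>UNIV. \<Sum>k<a. of_nat (count_words d e n k) :: rat) =
      (\<Sum>k<a. fps_nth (level_fps d n (d (n - 1)) + level_fps d n (\<not> d (n - 1))) k)"
  proof (subst sum.swap, intro sum.cong refl)
    fix k
    show "(\<Sum>e\<in>UNIV. of_nat (count_words d e n k)) =
        fps_nth (level_fps d n (d (n - 1)) + level_fps d n (\<not> d (n - 1))) k"
      by (cases "d (n - 1)"; cases "even k") (simp_all add: level_fps_def UNIV_bool)
  qed
  also have "\<dots> = zigzag_coeff n a (turns d n)"
  proof (cases "n = 1")
    case True
    have "turns d 1 = 0" by (simp add: turns_def)
    then show ?thesis using True
      by (simp add: zigzag_coeff_def level_fps_def numeral_fps_const)
  next
    case False
    then have "n \<ge> 2" using assms by simp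
    from level_fps_eq_turn_fps[OF this] show ?thesis using False
      by (simp only: zigzag_coeff_def distrib_right mult_1 if_False)
  qed
  finally show ?thesis .
qed

section \<open>Words sorting to a given permutation\<close>

lemma zigzag_less_lift_Suc:
  assumes "i < j" and "\<And>k. i \<le> k \<Longrightarrow> k < j \<Longrightarrow> zigzag_less e w (\<sigma> k) (\<sigma> (Suc k))"
  shows "zigzag_less e w (\<sigma> i) (\<sigma> j)"
  using assms(1)[THEN Suc_leI] assms(2)
proof (induction j rule: nat_induct_at_least)
  case (Suc j)
  then have "zigzag_less e w (\<sigma> i) (\<sigma> j)" "zigzag_less e w (\<sigma> j) (\<sigma> (Suc j))" by simp_all
  then show ?case using zigzag_less_order(1) by (rule transpD[rotated])
qed simp_all

text \<open>By transitivity only neighbouring places matter, and there ties are broken by whether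
  \<open>\<sigma>\<close> ascends.\<close>

lemma sorts_zigzag_iff_step_ok:
  assumes "\<sigma> permutes {1..n}"
  shows "sorts (zigzag_less e w) n \<sigma> \<longleftrightarrow>
    (\<forall>i\<in>{1..<n}. step_ok e (\<sigma> i < \<sigma> (Suc i)) (w (\<sigma> i)) (w (\<sigma> (Suc i))))"
proof -
  have step: "zigzag_less e w (\<sigma> i) (\<sigma> (Suc i)) \<longleftrightarrow>
      step_ok e (\<sigma> i < \<sigma> (Suc i)) (w (\<sigma> i)) (w (\<sigma> (Suc i)))" for i
  proof -
    have "\<sigma> i \<noteq> \<sigma> (Suc i)" using assms by (metis inj_eq n_not_Suc_n permutes_inj)
    then show ?thesis by (auto simp: zigzag_less_def step_ok_def)
  qed
  have "sorts (zigzag_less e w) n \<sigma> \<longleftrightarrow>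
      (\<forall>i\<in>{1..<n}. zigzag_less e w (\<sigma> i) (\<sigma> (Suc i)))"
    unfolding sorts_def by (auto intro: zigzag_less_lift_Suc)
  then show ?thesis by (simp only: step)
qed

text \<open>Turns a bound on the last label into a bound on the whole alphabet.\<close>

lemma monotone_words_le:
  assumes "v \<in> monotone_words d e n k" "i \<in> {1..n}"
  shows "v i \<le> k"
proof -
  have "v i \<le> v n" if "i \<le> n"
    using that
  proof (induction rule: inc_induct)
    case (step j)
    then have "step_ok e (d j) (v j) (v (Suc j))"
      using assms by (auto simp: monotone_words_def)
    then show ?case using step.IH by (auto simp: step_ok_def)
  qed simp
  then show ?thesis using assms by (auto simp: monotone_words_def)
qed

text \<open>Reading \<open>w\<close> along \<open>\<sigma>\<close> gives a label sequence whose
  steps are constrained by the ascents of \<open>\<sigma>\<close>; these sequences are grouped by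
  their last label.\<close>

lemma card_words_sorting_to:
  assumes "n \<ge> 1" "\<sigma> permutes {1..n}"
  shows "card {w \<in> words n a. zigzag_sort n e w = \<sigma>} =
    (\<Sum>k<a. count_words (\<lambda>i. \<sigma> i < \<sigma> (Suc i)) e n k)"
proof -
  let ?d = "\<lambda>i. \<sigma> i < \<sigma> (Suc i)"
  have "bij_betw (\<lambda>w. w \<circ> \<sigma>) {w \<in> words n a. zigzag_sort n e w = \<sigma>}
      (\<Union>k<a. monotone_words ?d e n k)"
  proof (rule bij_betw_byWitness[where f' = "\<lambda>v. v \<circ> inv \<sigma>"])
    show "(\<lambda>w. w \<circ> \<sigma>) ` {w \<in> words n a. zigzag_sort n e w = \<sigma>} \<subseteq>
        (\<Union>k<a. monotone_words ?d e n k)"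
    proof clarify
      fix w assume w: "w \<in> words n a" and \<sigma>: "\<sigma> = zigzag_sort n e w"
      have ext: "w \<circ> \<sigma> \<in> words n a" by (rule compose_words[OF w assms(2)])
      then have "(w \<circ> \<sigma>) n < a" "w \<circ> \<sigma> \<in> {1..n} \<rightarrow>\<^sub>E UNIV"
        using assms(1) by (auto simp: PiE_iff)
      moreover have "sorts (zigzag_less e w) n \<sigma>" using \<sigma> by (metis zigzag_sort_eq_iff)
      ultimately have "w \<circ> \<sigma> \<in> monotone_words ?d e n ((w \<circ> \<sigma>) n)"
        unfolding monotone_words_def sorts_zigzag_iff_step_ok[OF assms(2)] by simp
      then show "w \<circ> zigzag_sort n e w \<in> (\<Union>k<a. monotone_words
          (\<lambda>i. zigzag_sort n e w i < zigzag_sort n e w (Suc i)) e n k)"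
        using \<open>(w \<circ> \<sigma>) n < a\<close> \<sigma> by blast
    qed
    show "(\<lambda>v. v \<circ> inv \<sigma>) ` (\<Union>k<a. monotone_words ?d e n k) \<subseteq>
        {w \<in> words n a. zigzag_sort n e w = \<sigma>}"
    proof clarify
      fix k v assume k: "k < a" and v: "v \<in> monotone_words ?d e n k"
      have "v i < a" if "i \<in> {1..n}" for i
        using monotone_words_le[OF v that] k by simp
      then have "v \<in> words n a"
        using v by (auto simp: monotone_words_def PiE_iff)
      then have "v \<circ> inv \<sigma> \<in> words n a"
        by (rule compose_words[OF _ permutes_inv[OF assms(2)]])
      moreover have "(v \<circ> inv \<sigma>) (\<sigma> i) = v i" for i
        using assms(2) by (simp add: permutes_inverses)
      then have "sorts (zigzag_less e (v \<circ> inv \<sigma>)) n \<sigma>"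
        using v unfolding sorts_zigzag_iff_step_ok[OF assms(2)] monotone_words_def by simp
      ultimately show "v \<circ> inv \<sigma> \<in> words n a \<and> zigzag_sort n e (v \<circ> inv \<sigma>) = \<sigma>"
        using assms(2) by (simp only: zigzag_sort_eq_iff simp_thms)
    qed
  qed (simp_all add: comp_assoc permutes_inv_o[OF assms(2)])
  then have "card {w \<in> words n a. zigzag_sort n e w = \<sigma>} =
      card (\<Union>k<a. monotone_words ?d e n k)"
    by (rule bij_betw_same_card)
  also have "\<dots> = (\<Sum>k<a. card (monotone_words ?d e n k))"
    using card_monotone_words[OF assms(1)]
    by (intro card_UN_disjoint) (auto simp: monotone_words_def)
  finally show ?thesis using card_monotone_words[OF assms(1)] by simp
qed

section \<open>Triangular relation between zigzag sums and class sums\<close>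

lemma reduced_turning_number_eq_turns:
  assumes "\<sigma> permutes {1..n}"
  shows "reduced_turning_number n \<sigma> = turns (\<lambda>i. \<sigma> i < \<sigma> (Suc i)) n"
proof -
  have "(int (\<sigma> i) - int (\<sigma> (i - 1))) * (int (\<sigma> (i + 1)) - int (\<sigma> i)) < 0 \<longleftrightarrow>
      (\<sigma> (i - 1) < \<sigma> (Suc (i - 1))) \<noteq> (\<sigma> i < \<sigma> (Suc i))" if "1 < i" for i
  proof -
    have "\<sigma> i \<noteq> \<sigma> (i - 1)" "\<sigma> (Suc i) \<noteq> \<sigma> i"
      using assms that by (simp_all add: inj_eq[OF permutes_inj])
    then show ?thesis using that by (auto simp: mult_less_0_iff)
  qed
  then show ?thesis
    unfolding reduced_turning_number_def turns_def
    by (intro arg_cong[where f = card] Collect_cong) auto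
qed

lemma lookup_class_sum:
  "Poly_Mapping.lookup (class_sum n f k) \<sigma> = (if \<sigma> \<in> sym_perms n \<and> f \<sigma> = k then 1 else 0)"
proof -
  have "finite {\<sigma> \<in> sym_perms n. f \<sigma> = k}"
    by (simp add: sym_perms_def finite_permutations)
  then show ?thesis
    by (simp add: class_sum_def lookup_sum lookup_single when_def)
qed

lemma lookup_zigzag_sum:
  assumes "n \<ge> 1"
  shows "Poly_Mapping.lookup (zigzag_sum n a) \<sigma> =
    (if \<sigma> \<in> sym_perms n then zigzag_coeff n a (reduced_turning_number n \<sigma>) else 0)"
proof -
  have "Poly_Mapping.lookup (zigzag_sum n a) \<sigma> =
      (\<Sum>e\<in>UNIV. of_nat (card {w \<in> words n a. zigzag_sort n e w = \<sigma>}))"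
    unfolding zigzag_sum_def
    by (simp add: lookup_sum lookup_single when_def finite_words flip: sum.inter_filter
        del: One_nat_def)
  also have "\<dots> = (if \<sigma> \<in> sym_perms n then zigzag_coeff n a (reduced_turning_number n \<sigma>) else 0)"
  proof (cases "\<sigma> permutes {1..n}")
    case True
    then show ?thesis
      unfolding card_words_sorting_to[OF assms True] of_nat_sum sum_count_words[OF assms]
      by (simp add: reduced_turning_number_eq_turns sym_perms_def)
  next
    case False
    then have "{w \<in> words n a. zigzag_sort n e w = \<sigma>} = {}" for e
      using zigzag_sort_permutes by blast
    then show ?thesis using False
      by (simp only: sym_perms_def card.empty of_nat_0 sum.neutral_const mem_Collect_eq if_False)
  qed
  finally show ?thesis .
qed

text \<open>Coefficients depend only on the turning number, and those with \<open>t \<ge> a\<close>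
  vanish, so the sum may stop before \<open>a\<close>.\<close>

lemma zigzag_sum_eq_class_sums:
  assumes "n \<ge> 1"
  shows "zigzag_sum n a =
    (\<Sum>t<a. qscale (zigzag_coeff n a t) (class_sum n (reduced_turning_number n) t))"
  by (rule poly_mapping_eqI)
    (simp add: lookup_zigzag_sum[OF assms] lookup_sum lookup_qscale lookup_class_sum
      zigzag_coeff_eq_0 if_distrib cong: if_cong)

lemma class_sum_eq_0:
  assumes "k \<notin> f ` sym_perms n"
  shows "class_sum n f k = 0"
  using assms by (intro poly_mapping_eqI) (auto simp: lookup_class_sum)

text \<open>Forward substitution: \<open>zigzag_sum n (Suc t)\<close> involves the class sums up to
  \<open>t\<close> only, and the one at \<open>t\<close> has an invertible coefficient.\<close>

lemma class_sum_in_span_zigzag_sums: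
  assumes "n \<ge> 1"
  shows "class_sum n (reduced_turning_number n) t \<in> QG.span (range (zigzag_sum n))"
proof (induction t rule: less_induct)
  case (less t)
  let ?c = "class_sum n (reduced_turning_number n)"
  let ?S = "QG.span (range (zigzag_sum n))"
  show ?case
  proof (cases "t \<in> reduced_turning_number n ` sym_perms n")
    case False
    then show ?thesis by (simp add: class_sum_eq_0 QG.span_zero)
  next
    case True
    \<comment> \<open>For \<open>n = 1\<close> the only attained value is 0, which gives the side
      condition of \<open>zigzag_coeff_neq_0\<close>.\<close>
    then have nz: "zigzag_coeff n (Suc t) t \<noteq> 0"
      by (intro zigzag_coeff_neq_0) (auto simp: reduced_turning_number_def)
    let ?r = "\<Sum>s<t. qscale (zigzag_coeff n (Suc t) s) (?c s)"
    have r: "?r \<in> ?S"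
      using less by (intro QG.span_sum QG.span_scale) simp
    have "qscale (inverse (zigzag_coeff n (Suc t) t)) (zigzag_sum n (Suc t) - ?r) \<in> ?S"
      by (rule QG.span_scale[OF QG.span_diff[OF QG.span_base[OF rangeI] r]])
    also have "zigzag_sum n (Suc t) - ?r = qscale (zigzag_coeff n (Suc t) t) (?c t)"
      by (simp add: zigzag_sum_eq_class_sums[OF assms])
    finally show ?thesis using nz by simp
  qed
qed

section \<open>The reduced turning algebra: closure, commutativity, basis\<close>

lemma reduced_turning_algebra_eq_span:
  assumes "n \<ge> 1"
  shows "reduced_turning_algebra n = QG.span (range (zigzag_sum n))"
proof (rule antisym)
  show "reduced_turning_algebra n \<subseteq> QG.span (range (zigzag_sum n))"
    unfolding reduced_turning_algebra_def
    using class_sum_in_span_zigzag_sums[OF assms] by (intro QG.span_minimal) auto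
  \<comment> \<open>Values \<open>t\<close> that are not attained are covered too, since their class
    sum is zero; the expansion of a zigzag sum may contain them.\<close>
  have "class_sum n (reduced_turning_number n) t \<in> reduced_turning_algebra n" for t
    by (cases "t \<in> reduced_turning_number n ` sym_perms n")
      (auto simp: reduced_turning_algebra_def class_sum_eq_0 QG.span_zero intro: QG.span_base)
  then show "QG.span (range (zigzag_sum n)) \<subseteq> reduced_turning_algebra n"
    unfolding reduced_turning_algebra_def
    by (intro QG.span_minimal)
      (auto simp: zigzag_sum_eq_class_sums[OF assms] intro!: QG.span_sum QG.span_scale)
qed

text \<open>By bilinearity, closure and commutativity pass from generators to the span, first in the
  right factor and then in the left.\<close>

lemma span_gmult_induct:
  assumes "x \<in> QG.span B" "y \<in> QG.span B"
    and "\<And>b c. b \<in> B \<Longrightarrow> c \<in> B \<Longrightarrow> b \<odot> c \<in> QG.span B \<and> b \<odot> c = c \<odot> b"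
  shows "x \<odot> y \<in> QG.span B \<and> x \<odot> y = y \<odot> x"
proof -
  have right: "b \<odot> y \<in> QG.span B \<and> b \<odot> y = y \<odot> b" if "b \<in> B" for b
    using assms(2)
  proof (induction y rule: QG.span_induct_alt)
    case base
    show ?case by (simp add: gmult_zero QG.span_zero)
  next
    case (step q c y)
    then show ?case using assms(3)[OF that step(1)]
      by (metis gmult_add_left gmult_add_right gmult_qscale_left gmult_qscale_right
          QG.span_add QG.span_scale)
  qed
  show ?thesis
    using assms(1)
  proof (induction x rule: QG.span_induct_alt)
    case base
    show ?case by (simp add: gmult_zero QG.span_zero)
  next
    case (step q b x)
    then show ?case using right[OF step(1)]
      by (metis gmult_add_left gmult_add_right gmult_qscale_left gmult_qscale_right
          QG.span_add QG.span_scale)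
  qed
qed

text \<open>Distinct classes have disjoint supports and attained ones are nonempty, so evaluating a
  combination at \<open>\<sigma>\<close> isolates the coefficient of the class of
  \<open>\<sigma>\<close>.\<close>

lemma is_basis_family_class_sums:
  "is_basis_family (f ` sym_perms n) (class_sum n f) (QG.span (class_sum n f ` f ` sym_perms n))"
proof -
  have inj: "inj_on (class_sum n f) (f ` sym_perms n)"
  proof (rule inj_onI, clarify)
    fix \<sigma> \<tau> assume "\<sigma> \<in> sym_perms n" "class_sum n f (f \<sigma>) = class_sum n f (f \<tau>)"
    then show "f \<sigma> = f \<tau>"
      using lookup_class_sum[of n f "f \<sigma>" \<sigma>] lookup_class_sum[of n f "f \<tau>" \<sigma>]
      by (auto split: if_splits)
  qed
  have fin: "finite (f ` sym_perms n)"
    by (simp add: sym_perms_def finite_permutations)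
  have "QG.independent (class_sum n f ` f ` sym_perms n)"
  proof (rule QG.independent_if_scalars_zero)
    fix q x
    assume sum: "(\<Sum>x\<in>class_sum n f ` f ` sym_perms n. qscale (q x) x) = 0"
      and "x \<in> class_sum n f ` f ` sym_perms n"
    then obtain \<sigma> where \<sigma>: "\<sigma> \<in> sym_perms n" "x = class_sum n f (f \<sigma>)" by auto
    have "0 = Poly_Mapping.lookup
        (\<Sum>k\<in>f ` sym_perms n. qscale (q (class_sum n f k)) (class_sum n f k)) \<sigma>"
      using sum by (simp add: sum.reindex[OF inj])
    also have "\<dots> = q x"
      using \<sigma> fin by (simp add: lookup_sum lookup_qscale lookup_class_sum if_distrib cong: if_cong)
    finally show "q x = 0" by simp
  qed (simp add: fin)
  then show ?thesis using inj by (simp add: is_basis_family_def)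
qed

theorem mainTheorem4:
  fixes n :: nat
  assumes "n \<ge> 1"
  shows "is_lumping n (reduced_turning_number n) \<and>
    subalgebra n (reduced_turning_algebra n) \<and>
    is_basis_family (reduced_turning_number n ` sym_perms n)
      (class_sum n (reduced_turning_number n)) (reduced_turning_algebra n) \<and>
    (\<forall>x\<in>reduced_turning_algebra n. \<forall>y\<in>reduced_turning_algebra n. x \<odot> y = y \<odot> x)"
proof -
  let ?A = "reduced_turning_algebra n"
  \<comment> \<open>On the generators H_a the product 2 H_ab lies in the span and is symmetric in
    \<open>a\<close> and \<open>b\<close>.\<close>
  have mult: "x \<odot> y \<in> ?A \<and> x \<odot> y = y \<odot> x" if "x \<in> ?A" "y \<in> ?A" for x y
    using that unfolding reduced_turning_algebra_eq_span[OF assms]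
  proof (rule span_gmult_induct, clarify)
    fix a b
    have "qscale 2 (zigzag_sum n (a * b)) \<in> QG.span (range (zigzag_sum n))"
      by (rule QG.span_scale[OF QG.span_base[OF rangeI]])
    then show "zigzag_sum n a \<odot> zigzag_sum n b \<in> QG.span (range (zigzag_sum n)) \<and>
        zigzag_sum n a \<odot> zigzag_sum n b = zigzag_sum n b \<odot> zigzag_sum n a"
      by (simp add: zigzag_sum_gmult mult.commute)
  qed
  have "QG.subspace (group_algebra n)"
    using keys_add keys_qscale unfolding QG.subspace_def group_algebra_def by fastforce
  moreover have "class_sum n (reduced_turning_number n) k \<in> group_algebra n" for k
    by (auto simp: group_algebra_def in_keys_iff lookup_class_sum split: if_splits)
  ultimately have "?A \<subseteq> group_algebra n"
    unfolding reduced_turning_algebra_def by (intro QG.span_minimal) auto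
  then have sub: "subalgebra n ?A"
    using mult by (simp add: subalgebra_def) (simp add: reduced_turning_algebra_def)
  moreover have basis: "is_basis_family (reduced_turning_number n ` sym_perms n)
      (class_sum n (reduced_turning_number n)) ?A"
    unfolding reduced_turning_algebra_def by (rule is_basis_family_class_sums)
  ultimately show ?thesis using mult by (auto simp: is_lumping_def)
qed

end
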